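(* Let $m\ge 2$ and let $\theta\in\mathbb{R}$ be the true ability parameter. For any item selection strategy $(\mathbf{b}_n)_{n\in\mathbb{N}}$ in a standard computerized adaptive test (without revision) based on the nominal response model, as $n\to\infty$ we have $$\hat\theta_n\to\theta \quad\text{and}\quad \frac{I_n(\hat\theta_n)}{I_n(\theta)}\to 1 \qquad \mathsf{P}_\theta\text{-almost surely}.$$
   Context: Nominal response model. Fix an integer $m\ge 2$ (number of categories). An item is characterized by real numbers $a_1,\dots,a_m,c_1,\dots,c_m$ with $\sum_{k=1}^m a_k=\sum_{k=1}^m c_k=0$, $\sum_{k=1}^m|a_k|\ne 0$ and $\sum_{k=1}^m|c_k|\neq 0$; it is identified with the vector $\mathbf{b}=(a_2,\dots,a_m,c_2,\dots,c_m)\in\mathbb{R}^{2m-2}$ (so $a_1=-\sum_{k\ge2}a_k$, $c_1=-\sum_{k\ge 2}c_k$). For $\theta\in\mathbb{R}$ and $1\le k\le m$ set $$p_k(\theta;\mathbf{b})=\frac{\exp(a_k\theta+c_k)}{\sum_{h=1}^m\exp(a_h\theta+c_h)},\qquad \bar a(\theta;\mathbf{b})=\sum_{h=1}^m a_h\,p_h(\theta;\mathbf{b}),$$ $$s(\theta;\mathbf{b},k)=a_k-\bar a(\theta;\mathbf{b}),\qquad J(\theta;\mathbf{b})=\sum_{k=1}^m\bigl(a_k-\bar a(\theta;\mathbf{b})\bigr)^2p_k(\theta;\mathbf{b}).$$ All item vectors take values in a fixed nonempty compact set $\mathbb{B}\subset\mathbb{R}^{2m-2}$, each element $(a_2,\dots,a_m,c_2,\dots,c_m)$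 of which, with $a_1=-\sum_{k\ge2}a_k$ and $c_1=-\sum_{k\ge2}c_k$, satisfies $\sum_{k=1}^m|a_k|\ne0$ and $\sum_{k=1}^m|c_k|\ne0$. Standard CAT. $X_i\in\{1,\dots,m\}$ is the response to item $i$, $i\in\mathbb{N}$; $\mathcal{F}_i=\sigma(X_1,\dots,X_i)$, with $\mathcal{F}_0$ trivial. An item selection strategy is a sequence $(\mathbf{b}_i)_{i\in\mathbb{N}}$ of $\mathbb{B}$-valued random vectors with $\mathbf{b}_{i+1}$ being $\mathcal{F}_i$-measurable for every $i\ge 0$. Under $\mathsf{P}_\theta$ the responses follow the nominal response model and are conditionally independent given the selected items, i.e. $\mathsf{P}_\theta(X_i=k\mid\mathcal{F}_{i-1})=p_k(\theta;\mathbf{b}_i)$ for all $i\ge1$, $1\le k\le m$. Score and information: for every $\vartheta\in\mathbb{R}$, $S_n(\vartheta)=\sum_{i=1}^n s(\vartheta;\mathbf{b}_i,X_i)$ and $I_n(\vartheta)=\sum_{i=1}^nJ(\vartheta;\mathbf{b}_i)$. Estimator: $\hat\theta_n$ is $\mathcal{F}_n$-measurable and is the (unique) root of $S_n(\cdot)$ whenever a root exists; when no root exists (which can only occur in an initial phase of the test) it is given by some arbitrary $\mathcal{F}_n$-measurable initialization rule. *)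

theory Defs
  imports "HOL-Probability.Probability"
begin

text \<open>
  The response categories are the elements of \<^typ>\<open>'n option\<close>: \<^const>\<open>None\<close> is category 1 and
  the remaining categories are indexed by the finite type \<open>'n\<close>. Hence the number of categories is
  \<open>m = CARD('n) + 1 \<ge> 2\<close>, and the pair of vectors
  \<open>((a\<^sub>2, \<dots>, a\<^sub>m), (c\<^sub>2, \<dots>, c\<^sub>m))\<close> is an element of a Euclidean space of dimension
  \<open>2 m - 2\<close>.
\<close>

type_synonym 'n item = "(real ^ 'n) \<times> (real ^ 'n)"

definition full_coeff :: "real ^ 'n::finite \<Rightarrow> 'n option \<Rightarrow> real" where
  "full_coeff v k = (case k of None \<Rightarrow> - (\<Sum>j\<in>UNIV. v $ j) | Some j \<Rightarrow> v $ j)"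

abbreviation slope :: "'n::finite item \<Rightarrow> 'n option \<Rightarrow> real" where
  "slope b \<equiv> full_coeff (fst b)"

abbreviation intercept :: "'n::finite item \<Rightarrow> 'n option \<Rightarrow> real" where
  "intercept b \<equiv> full_coeff (snd b)"

lemma sum_full_coeff: "(\<Sum>k\<in>UNIV. full_coeff v k) = 0"
  by (simp add: UNIV_option_conv sum.reindex full_coeff_def)

definition item_bank :: "'n::finite item set \<Rightarrow> bool" where
  "item_bank B \<longleftrightarrow> compact B \<and> B \<noteq> {} \<and>
     (\<forall>b\<in>B. (\<Sum>k\<in>UNIV. \<bar>slope b k\<bar>) \<noteq> 0 \<and> (\<Sum>k\<in>UNIV. \<bar>intercept b k\<bar>) \<noteq> 0)"

definition category_prob :: "real \<Rightarrow> 'n::finite item \<Rightarrow> 'n option \<Rightarrow> real" where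
  "category_prob t b k =
     exp (slope b k * t + intercept b k) / (\<Sum>h\<in>UNIV. exp (slope b h * t + intercept b h))"

definition mean_slope :: "real \<Rightarrow> 'n::finite item \<Rightarrow> real" where
  "mean_slope t b = (\<Sum>h\<in>UNIV. slope b h * category_prob t b h)"

definition item_score :: "real \<Rightarrow> 'n::finite item \<Rightarrow> 'n option \<Rightarrow> real" where
  "item_score t b k = slope b k - mean_slope t b"

definition item_info :: "real \<Rightarrow> 'n::finite item \<Rightarrow> real" where
  "item_info t b = (\<Sum>k\<in>UNIV. (slope b k - mean_slope t b)\<^sup>2 * category_prob t b k)"

text \<open>
  All sequences of responses, items and estimators are indexed from 1; their values at index 0 are
  never used. The next definition is the \<open>\<sigma>\<close>-algebra generated by \<open>X\<^sub>1, \<dots>, X\<^sub>n\<close>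
  on the sample space of \<open>M\<close>, which is trivial for \<open>n = 0\<close>.
\<close>

definition response_algebra ::
    "'w measure \<Rightarrow> (nat \<Rightarrow> 'w \<Rightarrow> 'n option) \<Rightarrow> nat \<Rightarrow> 'w measure" where
  "response_algebra M X n = sigma (space M) {X i -` A \<inter> space M | i A. i \<in> {1..n}}"

lemma subalgebra_response_algebra:
  assumes "\<And>i. i \<ge> 1 \<Longrightarrow> X i \<in> M \<rightarrow>\<^sub>M count_space UNIV"
  shows "subalgebra M (response_algebra M X n)"
proof -
  have "{X i -` A \<inter> space M | i A. i \<in> {1..n}} \<subseteq> sets M"
    using assms by (auto intro: measurable_sets)
  then show ?thesis
    unfolding subalgebra_def response_algebra_def
    by (simp add: sets.sigma_sets_subset space_measure_of_conv sets_measure_of_conv)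
qed

definition item_selection_strategy ::
    "'w measure \<Rightarrow> 'n::finite item set \<Rightarrow> (nat \<Rightarrow> 'w \<Rightarrow> 'n option) \<Rightarrow> (nat \<Rightarrow> 'w \<Rightarrow> 'n item) \<Rightarrow> bool" where
  "item_selection_strategy M B X b \<longleftrightarrow>
     (\<forall>i. \<forall>\<omega>\<in>space M. b (Suc i) \<omega> \<in> B) \<and>
     (\<forall>i. b (Suc i) \<in> response_algebra M X i \<rightarrow>\<^sub>M borel)"

text \<open>
  \<open>M\<close> plays the role of the distribution for the ability parameter \<open>\<theta>\<close>.
\<close>

definition nominal_responses ::
    "'w measure \<Rightarrow> real \<Rightarrow> (nat \<Rightarrow> 'w \<Rightarrow> 'n::finite option) \<Rightarrow> (nat \<Rightarrow> 'w \<Rightarrow> 'n item) \<Rightarrow> bool" where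
  "nominal_responses M \<theta> X b \<longleftrightarrow>
     (\<forall>i\<ge>1. X i \<in> M \<rightarrow>\<^sub>M count_space UNIV) \<and>
     (\<forall>i\<ge>1. \<forall>k. AE \<omega> in M.
        real_cond_exp M (response_algebra M X (i - 1)) (indicator (X i -` {k} \<inter> space M)) \<omega>
          = category_prob \<theta> (b i \<omega>) k)"

definition score ::
    "(nat \<Rightarrow> 'w \<Rightarrow> 'n::finite option) \<Rightarrow> (nat \<Rightarrow> 'w \<Rightarrow> 'n item) \<Rightarrow> nat \<Rightarrow> real \<Rightarrow> 'w \<Rightarrow> real" where
  "score X b n t \<omega> = (\<Sum>i=1..n. item_score t (b i \<omega>) (X i \<omega>))"

definition info :: "(nat \<Rightarrow> 'w \<Rightarrow> 'n::finite item) \<Rightarrow> nat \<Rightarrow> real \<Rightarrow> 'w \<Rightarrow> real" where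
  "info b n t \<omega> = (\<Sum>i=1..n. item_info t (b i \<omega>))"

text \<open>
  For \<open>n \<ge> 1\<close> the score is strictly decreasing in the ability, so it has at most one root.
  On the event that there is no root only measurability is required, which is the arbitrary
  initialization rule.
\<close>

definition score_root_estimator ::
    "'w measure \<Rightarrow> (nat \<Rightarrow> 'w \<Rightarrow> 'n::finite option) \<Rightarrow> (nat \<Rightarrow> 'w \<Rightarrow> 'n item) \<Rightarrow>
      (nat \<Rightarrow> 'w \<Rightarrow> real) \<Rightarrow> bool" where
  "score_root_estimator M X b est \<longleftrightarrow>
     (\<forall>n\<ge>1. est n \<in> response_algebra M X n \<rightarrow>\<^sub>M borel \<and>
        (\<forall>\<omega>\<in>space M. (\<exists>t. score X b n t \<omega> = 0) \<longrightarrow> score X b n (est n \<omega>) \<omega> = 0))"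

end

theory Submission
  imports Defs "HOL-Library.Discrete_Functions"
begin

text \<open>
  The item scores at the true ability are bounded martingale differences, hence uncorrelated, so
  their average tends to 0 almost surely. The score has derivative minus the information, and by
  compactness of the item bank the information of an item is at least some \<open>\<delta> > 0\<close> for
  all abilities within distance 1 of \<open>\<theta>\<close>. Therefore \<open>S\<^sub>n (\<theta> + \<epsilon>) < 0 < S\<^sub>n (\<theta> - \<epsilon>)\<close>
  eventually, which traps the root. The convergence of the information ratio follows from
  uniform continuity of the item information on compact sets and \<open>I\<^sub>n (\<theta>) \<ge> n \<delta>\<close>.
\<close>

section \<open>Strong law of large numbers for bounded uncorrelated variables\<close>

text \<open>The distance from \<open>n\<close> down to the nearest square is of order sqrt n, so
  with increments bounded by \<open>C\<close> the change since that square is negligible against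
  \<open>n\<close>.\<close>

lemma tendsto_average_of_squares:
  fixes s :: "nat \<Rightarrow> real"
  assumes step: "\<And>n. \<bar>s (Suc n) - s n\<bar> \<le> C"
    and lim: "(\<lambda>k. s (k\<^sup>2) / real (k\<^sup>2)) \<longlonglongrightarrow> 0"
  shows "(\<lambda>n. s n / real n) \<longlonglongrightarrow> 0"
proof -
  have C: "0 \<le> C" using step[of 0] by linarith
  have gap: "\<bar>s (m + d) - s m\<bar> \<le> real d * C" for m d
  proof (induction d)
    case (Suc d)
    then show ?case using step[of "m + d"] by (simp add: algebra_simps)
  qed simp
  have bound: "\<bar>s n / real n\<bar> \<le>
      \<bar>s ((floor_sqrt n)\<^sup>2) / real ((floor_sqrt n)\<^sup>2)\<bar> + 2 * C / real (floor_sqrt n)"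
    if "n > 0" for n
  proof -
    define k where "k = floor_sqrt n"
    have k0: "k > 0" using that by (simp add: k_def)
    have le: "k\<^sup>2 \<le> n" by (simp add: k_def)
    \<comment> \<open>Consecutive squares differ by \<open>2 * k + 1\<close>; this gives the error
      \<open>2 * k * C\<close>, hence \<open>2 * C / k\<close> after division by
      \<open>k\<^sup>2\<close>.\<close>
    have "n < (Suc k)\<^sup>2" unfolding k_def by (rule Suc_floor_sqrt_power2_gt)
    then have d: "n - k\<^sup>2 \<le> 2 * k" by (simp add: power2_eq_square)
    have "\<bar>s n - s (k\<^sup>2)\<bar> \<le> real (n - k\<^sup>2) * C"
      using gap[of "k\<^sup>2" "n - k\<^sup>2"] le by simp
    also have "\<dots> \<le> real (2 * k) * C"
      using d C by (intro mult_right_mono) (simp_all only: of_nat_le_iff)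
    finally have "\<bar>s n\<bar> \<le> \<bar>s (k\<^sup>2)\<bar> + 2 * real k * C" by simp
    then have "\<bar>s n\<bar> / real n \<le> (\<bar>s (k\<^sup>2)\<bar> + 2 * real k * C) / real (k\<^sup>2)"
      using le k0 C by (intro frac_le) (simp_all only: of_nat_le_iff, simp_all)
    also have "\<dots> = \<bar>s (k\<^sup>2)\<bar> / real (k\<^sup>2) + 2 * C / real k"
      using k0 by (simp add: field_simps power2_eq_square)
    finally show ?thesis by (simp add: k_def abs_divide)
  qed
  have top: "filterlim floor_sqrt at_top sequentially"
    unfolding filterlim_at_top
  proof
    fix K
    have "K \<le> floor_sqrt n" if "n \<ge> K\<^sup>2" for n
      using mono_floor_sqrt'[OF that] by simp
    then show "\<forall>\<^sub>F n in sequentially. K \<le> floor_sqrt n"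
      by (rule eventually_sequentiallyI)
  qed
  have "(\<lambda>k. \<bar>s (k\<^sup>2) / real (k\<^sup>2)\<bar> + 2 * C / real k) \<longlonglongrightarrow> \<bar>0\<bar> + 0"
    by (intro tendsto_intros lim lim_const_over_n)
  from filterlim_compose[OF this top]
  have "(\<lambda>n. \<bar>s ((floor_sqrt n)\<^sup>2) / real ((floor_sqrt n)\<^sup>2)\<bar> + 2 * C / real (floor_sqrt n))
      \<longlonglongrightarrow> 0" by simp
  then show ?thesis
    by (rule Lim_null_comparison[rotated])
      (use bound in \<open>auto intro: eventually_sequentiallyI[of 1]\<close>)
qed

text \<open>
  By Chebyshev-type bounds the averages along the squares are square summable; boundedness
  controls the sums between consecutive squares.
\<close>

lemma (in prob_space) strong_law_bounded_uncorrelated: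
  fixes D :: "nat \<Rightarrow> 'a \<Rightarrow> real"
  assumes D [measurable]: "\<And>i. D i \<in> borel_measurable M"
    and bounded: "\<And>i \<omega>. \<omega> \<in> space M \<Longrightarrow> \<bar>D i \<omega>\<bar> \<le> C"
    and uncorrelated: "\<And>i j. i < j \<Longrightarrow> expectation (\<lambda>\<omega>. D i \<omega> * D j \<omega>) = 0"
  shows "AE \<omega> in M. (\<lambda>n. (\<Sum>i<n. D i \<omega>) / real n) \<longlonglongrightarrow> 0"
proof -
  define S where "S n \<omega> = (\<Sum>i<n. D i \<omega>)" for n \<omega>
  have S [measurable]: "S n \<in> borel_measurable M" for n unfolding S_def by measurable
  have C: "0 \<le> C" using bounded not_empty abs_ge_zero order_trans by blast
  have Sb: "\<bar>S n \<omega>\<bar> \<le> real n * C" if "\<omega> \<in> space M" for n \<omega>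
    unfolding S_def using sum_norm_bound[of "{..<n}" "\<lambda>i. D i \<omega>" C] bounded[OF that] by simp
  have int: "integrable M (\<lambda>\<omega>. D i \<omega> * D j \<omega>)" for i j
    by (rule integrable_const_bound[where B = "C * C"])
      (auto simp: abs_mult intro!: AE_I2 mult_mono bounded C)
  have intS: "integrable M (\<lambda>\<omega>. S n \<omega> * S n \<omega>)" for n
    by (rule integrable_const_bound[where B = "real n * C * (real n * C)"])
      (measurable, intro AE_I2, simp only: real_norm_def abs_mult,
        intro mult_mono Sb mult_nonneg_nonneg C, simp_all)
  \<comment> \<open>Orthogonality removes the cross term at each step, so the second moment grows
    linearly rather than quadratically.\<close>
  have var: "expectation (\<lambda>\<omega>. S n \<omega> * S n \<omega>) \<le> real n * C\<^sup>2" for n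
  proof (induction n)
    case 0
    then show ?case by (simp add: S_def)
  next
    case (Suc n)
    have "expectation (\<lambda>\<omega>. S n \<omega> * D n \<omega>) = (\<Sum>i<n. expectation (\<lambda>\<omega>. D i \<omega> * D n \<omega>))"
      unfolding S_def sum_distrib_right by (rule Bochner_Integration.integral_sum) (rule int)
    also have "\<dots> = 0" by (simp add: uncorrelated)
    finally have cross: "expectation (\<lambda>\<omega>. S n \<omega> * D n \<omega>) = 0" .
    have intSD: "integrable M (\<lambda>\<omega>. S n \<omega> * D n \<omega>)"
      unfolding S_def sum_distrib_right by (intro Bochner_Integration.integrable_sum int)
    have D2: "expectation (\<lambda>\<omega>. D n \<omega> * D n \<omega>) \<le> C\<^sup>2"
    proof -
      have "expectation (\<lambda>\<omega>. D n \<omega> * D n \<omega>) \<le> expectation (\<lambda>_. C\<^sup>2)"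
        by (rule integral_mono[OF int])
          (use bounded C in \<open>auto simp: power2_eq_square abs_le_square_iff[symmetric]
            simp flip: power2_eq_square\<close>)
      then show ?thesis by (simp add: prob_space)
    qed
    have "expectation (\<lambda>\<omega>. S (Suc n) \<omega> * S (Suc n) \<omega>)
        = expectation (\<lambda>\<omega>. S n \<omega> * S n \<omega> + 2 * (S n \<omega> * D n \<omega>) + D n \<omega> * D n \<omega>)"
      by (rule Bochner_Integration.integral_cong) (simp_all add: S_def algebra_simps)
    also have "\<dots> = expectation (\<lambda>\<omega>. S n \<omega> * S n \<omega>) + expectation (\<lambda>\<omega>. D n \<omega> * D n \<omega>)"
      using cross int intS intSD by simp
    finally show ?case using Suc D2 by (simp add: algebra_simps)
  qed
  define Q where "Q k \<omega> = (S (k\<^sup>2) \<omega> / real (k\<^sup>2))\<^sup>2" for k \<omega>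
  have Q [measurable]: "Q k \<in> borel_measurable M" for k unfolding Q_def by measurable
  have Q_eq: "Q k = (\<lambda>\<omega>. S (k\<^sup>2) \<omega> * S (k\<^sup>2) \<omega> / (real (k\<^sup>2))\<^sup>2)" for k
    by (rule ext) (simp only: Q_def power_divide power2_eq_square times_divide_times_eq)
  have Qint: "(\<integral>\<^sup>+\<omega>. ennreal (Q k \<omega>) \<partial>M) \<le> ennreal (C\<^sup>2 / real k ^ 2)" for k
  proof -
    have i: "integrable M (Q k)"
      unfolding Q_eq by (rule integrable_divide_zero) (rule intS)
    have e: "expectation (Q k) = expectation (\<lambda>\<omega>. S (k\<^sup>2) \<omega> * S (k\<^sup>2) \<omega>) / (real (k\<^sup>2))\<^sup>2"
      unfolding Q_eq by (rule integral_divide_zero)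
    have "expectation (Q k) \<le> (real (k\<^sup>2) * C\<^sup>2) / (real (k\<^sup>2))\<^sup>2"
      unfolding e by (intro divide_right_mono var) simp
    \<comment> \<open>At \<open>k = 0\<close> both sides are 0, because division by zero yields
      0.\<close>
    also have "\<dots> = C\<^sup>2 / real k ^ 2"
      by (cases "k = 0") (simp_all add: field_simps power2_eq_square)
    finally show ?thesis
      using nn_integral_eq_integral[OF i] by (simp add: Q_def ennreal_leI)
  qed
  have "summable (\<lambda>k. C\<^sup>2 * inverse (real k ^ 2))"
    by (intro summable_mult inverse_power_summable) simp
  then have summ: "summable (\<lambda>k. C\<^sup>2 / real k ^ 2)" by (simp add: divide_inverse)
  \<comment> \<open>Tonelli in place of Borel-Cantelli: a nonnegative series with finite expectation
    converges almost surely, so its terms tend to 0.\<close>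
  have "(\<integral>\<^sup>+\<omega>. (\<Sum>k. ennreal (Q k \<omega>)) \<partial>M) = (\<Sum>k. \<integral>\<^sup>+\<omega>. ennreal (Q k \<omega>) \<partial>M)"
    by (rule nn_integral_suminf) measurable
  also have "\<dots> \<le> (\<Sum>k. ennreal (C\<^sup>2 / real k ^ 2))"
    by (intro suminf_le Qint) auto
  also have "\<dots> < \<infinity>"
    using summ by (simp add: suminf_ennreal2 less_top)
  finally have "AE \<omega> in M. (\<Sum>k. ennreal (Q k \<omega>)) \<noteq> \<infinity>"
    by (intro nn_integral_PInf_AE) (auto simp: less_top)
  then show ?thesis
  proof (rule AE_mp, intro AE_I2 impI)
    fix \<omega> assume \<omega>: "\<omega> \<in> space M" and "(\<Sum>k. ennreal (Q k \<omega>)) \<noteq> \<infinity>"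
    then have "summable (\<lambda>k. Q k \<omega>)"
      by (intro summable_suminf_not_top) (auto simp: Q_def)
    then have "(\<lambda>k. (S (k\<^sup>2) \<omega> / real (k\<^sup>2))\<^sup>2) \<longlonglongrightarrow> 0"
      unfolding Q_def by (rule summable_LIMSEQ_zero)
    then have "(\<lambda>k. S (k\<^sup>2) \<omega> / real (k\<^sup>2)) \<longlonglongrightarrow> 0"
      by (simp add: power_tendsto_0_iff)
    then have "(\<lambda>n. S n \<omega> / real n) \<longlonglongrightarrow> 0"
      by (rule tendsto_average_of_squares[where C = C, rotated])
        (use bounded[OF \<omega>] in \<open>simp add: S_def\<close>)
    then show "(\<lambda>n. (\<Sum>i<n. D i \<omega>) / real n) \<longlonglongrightarrow> 0" by (simp add: S_def)
  qed
qed

section \<open>Category probabilities and positivity of the item information\<close>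

lemma partition_pos: "(\<Sum>h\<in>UNIV. exp (slope b h * t + intercept b h)) > (0::real)"
  by (rule sum_pos) auto

lemma category_prob_pos: "category_prob t b k > 0"
  unfolding category_prob_def by (simp add: partition_pos)

lemma sum_category_prob: "(\<Sum>k\<in>UNIV. category_prob t b k) = 1"
  using partition_pos[of b t] unfolding category_prob_def
  by (simp flip: sum_divide_distrib)

lemma item_info_nonneg: "item_info t b \<ge> 0"
  unfolding item_info_def by (intro sum_nonneg mult_nonneg_nonneg) (auto simp: category_prob_pos less_imp_le)

text \<open>The information is the variance of the slope under strictly positive weights, so it
  vanishes only if all slopes coincide. As the slopes sum to 0, they would then all be 0.\<close>

lemma item_info_pos:
  assumes "(\<Sum>k\<in>UNIV. \<bar>slope b k\<bar>) \<noteq> 0"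
  shows "item_info t b > 0"
proof (rule ccontr)
  assume "\<not> item_info t b > 0"
  then have "item_info t b = 0" using item_info_nonneg[of t b] by linarith
  then have "\<forall>k\<in>UNIV. (slope b k - mean_slope t b)\<^sup>2 * category_prob t b k = 0"
    unfolding item_info_def
    by (subst (asm) sum_nonneg_eq_0_iff) (auto simp: category_prob_pos less_imp_le)
  then have eq: "slope b k = mean_slope t b" for k
    using category_prob_pos[of t b k] by (metis UNIV_I eq_iff_diff_eq_0 less_irrefl mult_eq_0_iff power_eq_0_iff)
  have "real CARD('a option) * mean_slope t b = 0"
    using sum_full_coeff[of "fst b"] by (simp add: eq)
  then have "mean_slope t b = 0" by simp
  then show False using assms by (simp add: eq)
qed

section \<open>Joint continuity in ability and item\<close>

lemma continuous_on_full_coeff [continuous_intros]: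
  "continuous_on A f \<Longrightarrow> continuous_on A (\<lambda>x. full_coeff (f x) k)"
  unfolding full_coeff_def by (cases k) (auto intro!: continuous_intros)

lemma continuous_on_category_prob [continuous_intros]:
  "continuous_on A f \<Longrightarrow> continuous_on A g \<Longrightarrow> continuous_on A (\<lambda>x. category_prob (f x) (g x) k)"
  unfolding category_prob_def
  by (intro continuous_intros ballI less_imp_neq[OF partition_pos, symmetric])

lemma continuous_on_mean_slope [continuous_intros]:
  "continuous_on A f \<Longrightarrow> continuous_on A g \<Longrightarrow> continuous_on A (\<lambda>x. mean_slope (f x) (g x))"
  unfolding mean_slope_def by (intro continuous_intros)

lemma continuous_on_item_score [continuous_intros]:
  "continuous_on A f \<Longrightarrow> continuous_on A g \<Longrightarrow> continuous_on A (\<lambda>x. item_score (f x) (g x) k)"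
  unfolding item_score_def by (intro continuous_intros)

lemma continuous_on_item_info [continuous_intros]:
  "continuous_on A f \<Longrightarrow> continuous_on A g \<Longrightarrow> continuous_on A (\<lambda>x. item_info (f x) (g x))"
  unfolding item_info_def by (intro continuous_intros)

section \<open>Monotonicity of the mean slope\<close>

text \<open>For fixed \<open>b\<close> the response is an exponential family in \<open>t\<close>
  with statistic \<open>slope b\<close>; the derivative of its mean is its variance. Hence
  \<open>item_score\<close> has derivative \<open>- item_info\<close> whatever the response.\<close>

lemma mean_slope_has_derivative:
  "((\<lambda>t. mean_slope t b) has_real_derivative item_info t b) (at t)"
proof -
  let ?p = "category_prob t b"
  define Z where "Z t = (\<Sum>h\<in>UNIV. exp (slope b h * t + intercept b h))" for t
  have Z: "Z t \<noteq> 0" for t using partition_pos[of b t] by (simp add: Z_def)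
  have dZ: "(Z has_real_derivative (\<Sum>h\<in>UNIV. slope b h * exp (slope b h * t + intercept b h))) (at t)"
    unfolding Z_def by (auto intro!: derivative_eq_intros sum.cong simp: mult.commute)
  have m: "(\<Sum>h\<in>UNIV. slope b h * exp (slope b h * t + intercept b h)) = mean_slope t b * Z t"
    using Z[of t] by (simp add: mean_slope_def category_prob_def Z_def sum_distrib_right)
  have dp: "((\<lambda>t. category_prob t b k) has_real_derivative ?p k * (slope b k - mean_slope t b)) (at t)" for k
    unfolding category_prob_def Z_def[symmetric]
    using dZ Z[of t] unfolding m
    by (auto intro!: derivative_eq_intros simp: field_simps)
  have "((\<lambda>t. mean_slope t b) has_real_derivative
      (\<Sum>k\<in>UNIV. slope b k * (?p k * (slope b k - mean_slope t b)))) (at t)"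
    unfolding mean_slope_def[of _ b]
    by (intro DERIV_sum DERIV_cmult dp[unfolded mean_slope_def])
  \<comment> \<open>One factor \<open>slope b k\<close> may be centred at the mean, because the
    deviations from the mean average to 0.\<close>
  moreover have "(\<Sum>k\<in>UNIV. slope b k * (?p k * (slope b k - mean_slope t b))) = item_info t b"
  proof -
    have "(\<Sum>k\<in>UNIV. slope b k * (?p k * (slope b k - mean_slope t b))) - item_info t b
        = (\<Sum>k\<in>UNIV. mean_slope t b * (slope b k * ?p k - mean_slope t b * ?p k))"
      unfolding item_info_def sum_subtractf[symmetric]
      by (intro sum.cong) (auto simp: algebra_simps power2_eq_square)
    also have "\<dots> = mean_slope t b * (mean_slope t b - mean_slope t b)"
      unfolding sum_distrib_left[symmetric] sum_subtractf
      by (simp add: sum_category_prob flip: mean_slope_def)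
    finally show ?thesis by simp
  qed
  ultimately show ?thesis by simp
qed

lemma mean_slope_mono: "s \<le> t \<Longrightarrow> mean_slope s b \<le> mean_slope t b"
  by (rule DERIV_nonneg_imp_nondecreasing) (use mean_slope_has_derivative item_info_nonneg in blast)+

section \<open>Bounds uniform over the compact item bank\<close>

text \<open>A continuous positive function attains a positive minimum on a compact set. Abilities
  are confined to radius 1 around \<theta> to make the domain compact.\<close>

lemma item_info_bounded_below:
  assumes "item_bank B"
  obtains \<delta> where "\<delta> > 0"
    "\<And>b t. b \<in> B \<Longrightarrow> \<bar>t - \<theta>\<bar> \<le> 1 \<Longrightarrow> item_info t b \<ge> \<delta>"
proof -
  let ?K = "cball \<theta> 1 \<times> B"
  have "compact ?K" "?K \<noteq> {}" using assms by (auto simp: item_bank_def compact_Times)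
  moreover have "continuous_on ?K (\<lambda>x. item_info (fst x) (snd x))"
    by (intro continuous_intros)
  ultimately have "\<exists>x\<in>?K. \<forall>y\<in>?K. item_info (fst x) (snd x) \<le> item_info (fst y) (snd y)"
    by (rule continuous_attains_inf)
  then obtain x where x: "x \<in> ?K"
    and min: "\<And>y. y \<in> ?K \<Longrightarrow> item_info (fst x) (snd x) \<le> item_info (fst y) (snd y)"
    by blast
  show thesis
  proof
    show "item_info (fst x) (snd x) > 0"
      using x assms by (intro item_info_pos) (auto simp: item_bank_def)
    show "item_info t b \<ge> item_info (fst x) (snd x)" if "b \<in> B" "\<bar>t - \<theta>\<bar> \<le> 1" for b t
      using min[of "(t, b)"] that by (auto simp: dist_real_def abs_minus_commute)
  qed
qed

text \<open>Uniform continuity on the compact product makes \<open>d\<close> independent of the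
  item, so the bound applies to all selected items at once.\<close>

lemma item_info_equicontinuous:
  assumes "item_bank B" "\<epsilon> > 0"
  obtains d where "d > 0"
    "\<And>b t. b \<in> B \<Longrightarrow> \<bar>t - \<theta>\<bar> \<le> 1 \<Longrightarrow> \<bar>t - \<theta>\<bar> < d \<Longrightarrow> \<bar>item_info t b - item_info \<theta> b\<bar> < \<epsilon>"
proof -
  let ?K = "cball \<theta> 1 \<times> B"
  have "compact ?K" using assms by (auto simp: item_bank_def compact_Times)
  moreover have "continuous_on ?K (\<lambda>x. item_info (fst x) (snd x))"
    by (intro continuous_intros)
  ultimately have "uniformly_continuous_on ?K (\<lambda>x. item_info (fst x) (snd x))"
    by (rule compact_uniformly_continuous[rotated])
  then obtain d where "d > 0" and d: "\<And>x y. x \<in> ?K \<Longrightarrow> y \<in> ?K \<Longrightarrow> dist y x < d \<Longrightarrow>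
      dist (item_info (fst y) (snd y)) (item_info (fst x) (snd x)) < \<epsilon>"
    using \<open>\<epsilon> > 0\<close> unfolding uniformly_continuous_on_def by metis
  show thesis
  proof
    show "\<bar>item_info t b - item_info \<theta> b\<bar> < \<epsilon>"
      if "b \<in> B" "\<bar>t - \<theta>\<bar> \<le> 1" "\<bar>t - \<theta>\<bar> < d" for b t
      using d[of "(\<theta>, b)" "(t, b)"] that
      by (auto simp: dist_real_def dist_Pair_Pair abs_minus_commute)
  qed fact
qed

text \<open>Each category gives a continuous function on the compact bank; the finitely many bounds
  are merged by summing their absolute values.\<close>

lemma item_score_bounded:
  assumes "item_bank B"
  obtains C where "\<And>b k. b \<in> B \<Longrightarrow> \<bar>item_score \<theta> b k\<bar> \<le> C"
proof -
  have "\<exists>c. \<forall>b\<in>B. \<bar>item_score \<theta> b k\<bar> \<le> c" for k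
  proof -
    have "bounded ((\<lambda>b. item_score \<theta> b k) ` B)"
      using assms by (intro compact_imp_bounded compact_continuous_image continuous_intros)
        (auto simp: item_bank_def)
    then show ?thesis by (auto simp: bounded_iff)
  qed
  then obtain c where c: "\<And>k b. b \<in> B \<Longrightarrow> \<bar>item_score \<theta> b k\<bar> \<le> c k" by metis
  have "\<bar>item_score \<theta> b k\<bar> \<le> (\<Sum>k\<in>UNIV. \<bar>c k\<bar>)" if "b \<in> B" for b k
    using c[OF that, of k] member_le_sum[of k UNIV "\<lambda>k. \<bar>c k\<bar>"] by fastforce
  then show thesis using that by blast
qed

section \<open>Pathwise analysis of the score and the information\<close>

text \<open>Holds for arbitrarily distant abilities, which is what excludes roots far from \<theta>;
  \<open>score_decrease\<close> is quantitative but only local.\<close>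

lemma score_antimono: "s \<le> t \<Longrightarrow> score X b n t \<omega> \<le> score X b n s \<omega>"
  unfolding score_def item_score_def by (intro sum_mono diff_mono order_refl mean_slope_mono)

text \<open>The responses cancel in the difference of two scores, leaving increments of
  \<open>mean_slope\<close>; the mean value theorem bounds each from below by
  \<open>(t - s) * \<delta>\<close>.\<close>

lemma score_decrease:
  assumes "\<And>i. b (Suc i) \<omega> \<in> B"
    and \<delta>: "\<And>b t. b \<in> B \<Longrightarrow> \<bar>t - \<theta>\<bar> \<le> 1 \<Longrightarrow> item_info t b \<ge> \<delta>"
    and "s \<le> t" "\<bar>s - \<theta>\<bar> \<le> 1" "\<bar>t - \<theta>\<bar> \<le> 1"
  shows "score X b n t \<omega> \<le> score X b n s \<omega> - real n * ((t - s) * \<delta>)"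
proof -
  have *: "mean_slope t c - mean_slope s c \<ge> (t - s) * \<delta>" if "c \<in> B" for c
  proof (cases "s < t")
    case True
    then obtain z where "s < z" "z < t" "mean_slope t c - mean_slope s c = (t - s) * item_info z c"
      using MVT2[of s t "\<lambda>t. mean_slope t c" "\<lambda>t. item_info t c"] mean_slope_has_derivative by metis
    moreover have "item_info z c \<ge> \<delta>" using \<delta>[OF that, of z] calculation assms by auto
    ultimately show ?thesis using True by (simp add: mult_left_mono)
  qed (use assms in simp)
  have "score X b n s \<omega> - score X b n t \<omega> = (\<Sum>i<n. mean_slope t (b (Suc i) \<omega>) - mean_slope s (b (Suc i) \<omega>))"
    unfolding score_def item_score_def sum_subtractf[symmetric]
    by (simp add: sum.atLeast1_atMost_eq)
  also have "\<dots> \<ge> (\<Sum>i<n. (t - s) * \<delta>)" by (intro sum_mono * assms)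
  finally show ?thesis by simp
qed

lemma score_root_near:
  assumes bank: "item_bank B" and items: "\<And>i. b (Suc i) \<omega> \<in> B"
    and lim: "(\<lambda>n. score X b n \<theta> \<omega> / real n) \<longlonglongrightarrow> 0"
    and root: "\<And>n. n \<ge> 1 \<Longrightarrow> \<exists>t. score X b n t \<omega> = 0 \<Longrightarrow> score X b n (est n) \<omega> = 0"
  shows "est \<longlonglongrightarrow> \<theta>"
proof -
  obtain \<delta> where \<delta>0: "\<delta> > 0"
    and \<delta>: "\<And>b t. b \<in> B \<Longrightarrow> \<bar>t - \<theta>\<bar> \<le> 1 \<Longrightarrow> item_info t b \<ge> \<delta>"
    using item_info_bounded_below[OF bank] by metis
  show ?thesis
  proof (rule LIMSEQ_I)
    fix r :: real assume "r > 0"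
    \<comment> \<open>The cap at 1 keeps both points at distance \<epsilon> within the range where
      \<delta> is a lower bound.\<close>
    define \<epsilon> where "\<epsilon> = min r 1"
    have \<epsilon>: "\<epsilon> > 0" "\<epsilon> \<le> 1" "\<epsilon> \<le> r" using \<open>r > 0\<close> by (auto simp: \<epsilon>_def)
    then have "\<epsilon> * \<delta> > 0" using \<delta>0 by simp
    from LIMSEQ_D[OF lim this] obtain N where
      N: "\<And>n. n \<ge> N \<Longrightarrow> \<bar>score X b n \<theta> \<omega> / real n\<bar> < \<epsilon> * \<delta>" by auto
    have "norm (est n - \<theta>) < r" if n: "n \<ge> max N 1" for n
    proof -
      have "\<bar>score X b n \<theta> \<omega>\<bar> < real n * (\<epsilon> * \<delta>)"
        using N[of n] n by (simp add: abs_divide field_simps)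
      moreover have "score X b n (\<theta> + \<epsilon>) \<omega> \<le> score X b n \<theta> \<omega> - real n * (\<epsilon> * \<delta>)"
        using score_decrease[where B = B and b = b and \<theta> = \<theta> and s = \<theta> and t = "\<theta> + \<epsilon>", OF items \<delta>] \<epsilon> by simp
      moreover have "score X b n \<theta> \<omega> \<le> score X b n (\<theta> - \<epsilon>) \<omega> - real n * (\<epsilon> * \<delta>)"
        using score_decrease[where B = B and b = b and \<theta> = \<theta> and s = "\<theta> - \<epsilon>" and t = \<theta>, OF items \<delta>] \<epsilon> by simp
      ultimately have neg: "score X b n (\<theta> + \<epsilon>) \<omega> < 0" and pos: "score X b n (\<theta> - \<epsilon>) \<omega> > 0"
        by linarith+
      have "continuous_on {\<theta> - \<epsilon>..\<theta> + \<epsilon>} (\<lambda>t. score X b n t \<omega>)"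
        unfolding score_def by (intro continuous_intros)
      \<comment> \<open>A root exists for this \<open>n\<close>, so the estimate is no longer set by
        the initialization rule.\<close>
      then have "\<exists>t. score X b n t \<omega> = 0"
        using IVT2'[of "\<lambda>t. score X b n t \<omega>" "\<theta> + \<epsilon>" 0 "\<theta> - \<epsilon>"] neg pos \<epsilon> by auto
      then have "score X b n (est n) \<omega> = 0" using root n by simp
      then have "est n < \<theta> + \<epsilon>" "est n > \<theta> - \<epsilon>"
        using neg pos score_antimono[of "\<theta> + \<epsilon>" "est n" X b n \<omega>]
          score_antimono[of "est n" "\<theta> - \<epsilon>" X b n \<omega>] by (auto simp: not_le[symmetric])
      then show ?thesis using \<epsilon> by (simp add: abs_less_iff)
    qed
    then show "\<exists>no. \<forall>n\<ge>no. norm (est n - \<theta>) < r" by blast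
  qed
qed

lemma info_ratio_tendsto:
  assumes bank: "item_bank B" and items: "\<And>i. b (Suc i) \<omega> \<in> B"
    and est: "est \<longlonglongrightarrow> \<theta>"
  shows "(\<lambda>n. info b n (est n) \<omega> / info b n \<theta> \<omega>) \<longlonglongrightarrow> 1"
proof -
  obtain \<delta> where \<delta>0: "\<delta> > 0"
    and \<delta>: "\<And>b t. b \<in> B \<Longrightarrow> \<bar>t - \<theta>\<bar> \<le> 1 \<Longrightarrow> item_info t b \<ge> \<delta>"
    using item_info_bounded_below[OF bank] by metis
  have info: "info b n t \<omega> = (\<Sum>i<n. item_info t (b (Suc i) \<omega>))" for n t
    by (simp add: info_def sum.atLeast1_atMost_eq)
  show ?thesis
  proof (rule LIMSEQ_I)
    fix r :: real assume r: "r > 0"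
    \<comment> \<open>With tolerance \<open>r * \<delta>\<close> per item, the total error stays
      below \<open>n * r * \<delta>\<close>, which is at most \<open>r\<close> times the information
      at \<theta>.\<close>
    then have "r * \<delta> > 0" using \<delta>0 by simp
    from item_info_equicontinuous[OF bank this] obtain d where "d > 0" and
      d: "\<And>b t. b \<in> B \<Longrightarrow> \<bar>t - \<theta>\<bar> \<le> 1 \<Longrightarrow> \<bar>t - \<theta>\<bar> < d \<Longrightarrow> \<bar>item_info t b - item_info \<theta> b\<bar> < r * \<delta>"
      by metis
    have "min d 1 > 0" using \<open>d > 0\<close> by simp
    from LIMSEQ_D[OF est this] obtain N where
      N: "\<And>n. n \<ge> N \<Longrightarrow> \<bar>est n - \<theta>\<bar> < min d 1" by auto
    \<comment> \<open>\<open>n \<ge> 1\<close> makes the denominator positive and the sum nonempty,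
      as the strict inequality requires.\<close>
    have "norm (info b n (est n) \<omega> / info b n \<theta> \<omega> - 1) < r" if n: "n \<ge> max N 1" for n
    proof -
      have low: "real n * \<delta> \<le> info b n \<theta> \<omega>"
        using sum_mono[of "{..<n}" "\<lambda>_. \<delta>" "\<lambda>i. item_info \<theta> (b (Suc i) \<omega>)"] \<delta> items
        by (simp add: info)
      have "0 < real n * \<delta>" using n \<delta>0 by simp
      then have pos: "info b n \<theta> \<omega> > 0" using low by linarith
      have "\<bar>info b n (est n) \<omega> - info b n \<theta> \<omega>\<bar>
          \<le> (\<Sum>i<n. \<bar>item_info (est n) (b (Suc i) \<omega>) - item_info \<theta> (b (Suc i) \<omega>)\<bar>)"
        unfolding info sum_subtractf[symmetric] by (rule sum_abs)
      also have "\<dots> < (\<Sum>i<n. r * \<delta>)"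
        using N[of n] n by (intro sum_strict_mono d items) (auto simp: lessThan_empty_iff)
      also have "\<dots> \<le> r * info b n \<theta> \<omega>"
        using low r by (simp add: mult.left_commute)
      finally show ?thesis using pos by (simp add: field_simps abs_less_iff)
    qed
    then show "\<exists>no. \<forall>n\<ge>no. norm (info b n (est n) \<omega> / info b n \<theta> \<omega> - 1) < r" by blast
  qed
qed

section \<open>Item scores as martingale differences\<close>

text \<open>Separates the response, present only in an indicator, from coefficients depending on the
  item alone, so that conditional expectations can be taken category by category.\<close>

lemma item_score_sum:
  "item_score t b x = (\<Sum>k\<in>UNIV. slope b k * (of_bool (x = k) - category_prob t b k))"
proof -
  have "(\<Sum>k\<in>UNIV. slope b k * of_bool (x = k)) = slope b x"
    by (subst sum.remove[of _ x]) auto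
  then show ?thesis
    by (simp add: item_score_def mean_slope_def right_diff_distrib sum_subtractf)
qed

lemma response_algebra_mono:
  assumes "m \<le> n"
  shows "sets (response_algebra M X m) \<subseteq> sets (response_algebra M X n)"
proof -
  have "{X i -` A \<inter> space M | i A. i \<in> {1..m}} \<subseteq> {X i -` A \<inter> space M | i A. i \<in> {1..n}}"
    using assms by fastforce
  then show ?thesis
    unfolding response_algebra_def
    by (subst (1 2) sets_measure_of) (auto intro!: sigma_sets_mono')
qed

lemma measurable_response_algebra:
  assumes "1 \<le> i" "i \<le> n"
  shows "X i \<in> response_algebra M X n \<rightarrow>\<^sub>M count_space UNIV"
proof (rule measurableI)
  fix A
  have "X i -` A \<inter> space M \<in> {X i -` A \<inter> space M | i A. i \<in> {1..n}}" using assms by auto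
  then show "X i -` A \<inter> space (response_algebra M X n) \<in> sets (response_algebra M X n)"
    unfolding response_algebra_def
    by (subst sets_measure_of) (auto simp: space_measure_of_conv intro: sigma_sets.Basic)
qed simp

text \<open>For a fixed category the score is continuous in the item; the random category is
  resolved by a finite sum over indicators.\<close>

lemma borel_measurable_item_score:
  fixes X :: "'w \<Rightarrow> 'n::finite option"
  assumes [measurable]: "b \<in> N \<rightarrow>\<^sub>M borel" "X \<in> N \<rightarrow>\<^sub>M count_space UNIV"
  shows "(\<lambda>\<omega>. item_score t (b \<omega>) (X \<omega>)) \<in> borel_measurable N"
proof -
  have [measurable]: "(\<lambda>\<omega>. item_score t (b \<omega>) k) \<in> borel_measurable N" for k
    by (rule measurable_compose[OF assms(1)])
      (intro borel_measurable_continuous_onI continuous_intros)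
  have "(\<lambda>\<omega>. \<Sum>k\<in>UNIV. item_score t (b \<omega>) k * of_bool (X \<omega> = k)) \<in> borel_measurable N"
    by measurable
  moreover have "(\<Sum>k\<in>UNIV. item_score t (b \<omega>) k * of_bool (X \<omega> = k)) = item_score t (b \<omega>) (X \<omega>)" for \<omega>
    by (subst sum.remove[of _ "X \<omega>"]) auto
  ultimately show ?thesis by simp
qed

lemma measurable_response_algebra_le:
  assumes "f \<in> response_algebra M X m \<rightarrow>\<^sub>M N" "m \<le> n"
  shows "f \<in> response_algebra M X n \<rightarrow>\<^sub>M N"
  using assms(1) response_algebra_mono[OF assms(2), of M X]
  by (auto simp: measurable_def response_algebra_def space_measure_of_conv)

text \<open>Given the first \<open>j\<close> responses the next item is known and its score has
  conditional mean 0. Taking an earlier item score for \<open>f\<close> shows that scores are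
  uncorrelated.\<close>

lemma (in prob_space) item_score_orthogonal:
  fixes X :: "nat \<Rightarrow> 'a \<Rightarrow> 'n::finite option"
  assumes bank: "item_bank B"
    and strategy: "item_selection_strategy M B X b"
    and resp: "nominal_responses M \<theta> X b"
    and f: "f \<in> borel_measurable (response_algebra M X j)"
    and fb: "\<And>\<omega>. \<omega> \<in> space M \<Longrightarrow> \<bar>f \<omega>\<bar> \<le> C"
  shows "expectation (\<lambda>\<omega>. f \<omega> * item_score \<theta> (b (Suc j) \<omega>) (X (Suc j) \<omega>)) = 0"
proof -
  let ?F = "response_algebra M X j"
  let ?I = "\<lambda>k. indicator (X (Suc j) -` {k} \<inter> space M) :: 'a \<Rightarrow> real"
  let ?p = "\<lambda>k \<omega>. category_prob \<theta> (b (Suc j) \<omega>) k"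
  have XM [measurable]: "i \<ge> 1 \<Longrightarrow> X i \<in> M \<rightarrow>\<^sub>M count_space UNIV" for i
    using resp by (simp add: nominal_responses_def)
  have sub: "subalgebra M ?F" by (rule subalgebra_response_algebra) (rule XM)
  interpret finite_measure_subalgebra M ?F by unfold_locales (rule sub)
  have bF: "b (Suc j) \<in> ?F \<rightarrow>\<^sub>M borel" and bB: "\<And>\<omega>. \<omega> \<in> space M \<Longrightarrow> b (Suc j) \<omega> \<in> B"
    using strategy by (auto simp: item_selection_strategy_def)
  have slopeF: "(\<lambda>\<omega>. slope (b (Suc j) \<omega>) k) \<in> borel_measurable ?F" for k
    by (rule measurable_compose[OF bF])
      (intro borel_measurable_continuous_onI continuous_intros)
  have pF: "?p k \<in> borel_measurable ?F" for k
    by (rule measurable_compose[OF bF])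
      (intro borel_measurable_continuous_onI continuous_intros)
  \<comment> \<open>All factors known before response \<open>Suc j\<close> are collected here, so
    that they can be pulled through the conditional expectation.\<close>
  define g where "g k \<omega> = f \<omega> * slope (b (Suc j) \<omega>) k" for k \<omega>
  have gF: "g k \<in> borel_measurable ?F" for k
    unfolding g_def by (intro borel_measurable_times f slopeF)
  note [measurable] = measurable_from_subalg[OF sub gF] measurable_from_subalg[OF sub pF]
  have C: "0 \<le> C" using fb not_empty abs_ge_zero order_trans by blast
  have "\<exists>c. \<forall>b\<in>B. \<bar>slope b k\<bar> \<le> c" for k
  proof -
    have "bounded ((\<lambda>b. slope b k) ` B)"
      using bank by (intro compact_imp_bounded compact_continuous_image continuous_intros)
        (auto simp: item_bank_def)
    then show ?thesis by (auto simp: bounded_iff)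
  qed
  then obtain c where c: "\<And>k b. b \<in> B \<Longrightarrow> \<bar>slope b k\<bar> \<le> c k" by metis
  have gb: "\<bar>g k \<omega>\<bar> \<le> C * c k" if "\<omega> \<in> space M" for k \<omega>
    unfolding g_def abs_mult by (intro mult_mono fb c bB that C) simp
  have gint: "integrable M (g k)" for k
    by (rule integrable_const_bound[where B = "C * c k"]) (auto intro!: AE_I2 gb)
  have gI: "integrable M (\<lambda>\<omega>. g k \<omega> * ?I k \<omega>)" for k
    by (rule integrable_real_mult_indicator) (auto intro: gint)
  have p1: "\<bar>?p k \<omega>\<bar> \<le> 1" for k \<omega>
    using member_le_sum[of k UNIV "\<lambda>k. ?p k \<omega>"] category_prob_pos[of \<theta> "b (Suc j) \<omega>"]
    by (simp add: sum_category_prob less_imp_le)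
  have gp: "integrable M (\<lambda>\<omega>. g k \<omega> * ?p k \<omega>)" for k
    by (rule Bochner_Integration.integrable_bound[OF gint[of k]])
      (auto simp: abs_mult intro!: AE_I2 mult_left_le p1)
  \<comment> \<open>Because \<open>g k\<close> is measurable with respect to the past, the indicator
    may be replaced by its conditional expectation, which the model identifies as
    \<open>?p k\<close>.\<close>
  have eq: "expectation (\<lambda>\<omega>. g k \<omega> * ?I k \<omega>) = expectation (\<lambda>\<omega>. g k \<omega> * ?p k \<omega>)" for k
  proof -
    have "expectation (\<lambda>\<omega>. g k \<omega> * ?I k \<omega>) = expectation (\<lambda>\<omega>. g k \<omega> * real_cond_exp M ?F (?I k) \<omega>)"
      by (rule real_cond_exp_intg(2)[OF gI gF, symmetric]) measurable
    also have "\<dots> = expectation (\<lambda>\<omega>. g k \<omega> * ?p k \<omega>)"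
    proof (rule integral_cong_AE)
      have "AE \<omega> in M. real_cond_exp M (response_algebra M X (Suc j - 1)) (?I k) \<omega> = ?p k \<omega>"
        by (rule resp[unfolded nominal_responses_def, THEN conjunct2, rule_format]) simp
      then show "AE \<omega> in M. g k \<omega> * real_cond_exp M ?F (?I k) \<omega> = g k \<omega> * ?p k \<omega>" by auto
    qed measurable
    finally show ?thesis .
  qed
  have "expectation (\<lambda>\<omega>. f \<omega> * item_score \<theta> (b (Suc j) \<omega>) (X (Suc j) \<omega>))
      = expectation (\<lambda>\<omega>. \<Sum>k\<in>UNIV. g k \<omega> * ?I k \<omega> - g k \<omega> * ?p k \<omega>)"
    unfolding item_score_sum sum_distrib_left
    by (intro Bochner_Integration.integral_cong sum.cong refl)
      (auto simp: g_def right_diff_distrib mult.assoc indicator_def of_bool_def)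
  also have "\<dots> = (\<Sum>k\<in>UNIV. expectation (\<lambda>\<omega>. g k \<omega> * ?I k \<omega>) - expectation (\<lambda>\<omega>. g k \<omega> * ?p k \<omega>))"
    by (subst Bochner_Integration.integral_sum) (auto intro!: sum.cong Bochner_Integration.integral_diff gI gp)
  also have "\<dots> = 0" by (simp add: eq)
  finally show ?thesis .
qed

section \<open>Almost sure convergence of the estimator and the information ratio\<close>

theorem theorem3p1:
  fixes M :: "'w measure"
    and \<theta> :: real
    and B :: "'n::finite item set"
    and X :: "nat \<Rightarrow> 'w \<Rightarrow> 'n option"
    and b :: "nat \<Rightarrow> 'w \<Rightarrow> 'n item"
    and est :: "nat \<Rightarrow> 'w \<Rightarrow> real"
  assumes "prob_space M"
    and "item_bank B"
    and "item_selection_strategy M B X b"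
    and "nominal_responses M \<theta> X b"
    and "score_root_estimator M X b est"
  shows "AE \<omega> in M.
    (\<lambda>n. est n \<omega>) \<longlonglongrightarrow> \<theta> \<and>
    (\<lambda>n. info b n (est n \<omega>) \<omega> / info b n \<theta> \<omega>) \<longlonglongrightarrow> 1"
proof -
  interpret prob_space M by fact
  \<comment> \<open>The shift matches sums over \<open>i < n\<close> with items numbered from 1;
    \<open>D i\<close> is determined by the first \<open>Suc i\<close> responses.\<close>
  define D where "D i \<omega> = item_score \<theta> (b (Suc i) \<omega>) (X (Suc i) \<omega>)" for i \<omega>
  have items: "b (Suc i) \<omega> \<in> B" if "\<omega> \<in> space M" for i \<omega>
    using assms(3) that by (auto simp: item_selection_strategy_def)
  obtain C where C: "\<And>b k. b \<in> B \<Longrightarrow> \<bar>item_score \<theta> b k\<bar> \<le> C"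
    using item_score_bounded[OF assms(2)] by metis
  have Db: "\<bar>D i \<omega>\<bar> \<le> C" if "\<omega> \<in> space M" for i \<omega>
    unfolding D_def by (intro C items that)
  have DF: "D i \<in> borel_measurable (response_algebra M X j)" if "i < j" for i j
    unfolding D_def
  proof (rule borel_measurable_item_score)
    show "b (Suc i) \<in> response_algebra M X j \<rightarrow>\<^sub>M borel"
    proof (rule measurable_response_algebra_le)
      show "b (Suc i) \<in> response_algebra M X i \<rightarrow>\<^sub>M borel"
        using assms(3) by (simp add: item_selection_strategy_def)
    qed (use that in simp)
    show "X (Suc i) \<in> response_algebra M X j \<rightarrow>\<^sub>M count_space UNIV"
      by (rule measurable_response_algebra) (use that in simp_all)
  qed
  have "AE \<omega> in M. (\<lambda>n. (\<Sum>i<n. D i \<omega>) / real n) \<longlonglongrightarrow> 0"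
  proof (rule strong_law_bounded_uncorrelated)
    show "D i \<in> borel_measurable M" for i
    proof (rule measurable_from_subalg)
      show "subalgebra M (response_algebra M X (Suc i))"
        using assms(4) by (intro subalgebra_response_algebra) (simp add: nominal_responses_def)
    qed (rule DF, simp)
    show "expectation (\<lambda>\<omega>. D i \<omega> * D j \<omega>) = 0" if "i < j" for i j
      \<comment> \<open>Only the later factor is unfolded: \<open>D i\<close> remains the bounded
        function of the first \<open>j\<close> responses.\<close>
      unfolding D_def[of j]
      by (rule item_score_orthogonal[OF assms(2-4) DF[OF that] Db])
  qed (rule Db)
  then show ?thesis
  proof (rule AE_mp, intro AE_I2 impI)
    fix \<omega> assume \<omega>: "\<omega> \<in> space M" and "(\<lambda>n. (\<Sum>i<n. D i \<omega>) / real n) \<longlonglongrightarrow> 0"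
    then have lim: "(\<lambda>n. score X b n \<theta> \<omega> / real n) \<longlonglongrightarrow> 0"
      by (simp add: score_def D_def sum.atLeast1_atMost_eq)
    have "score X b n (est n \<omega>) \<omega> = 0" if "n \<ge> 1" "\<exists>t. score X b n t \<omega> = 0" for n
      using assms(5) \<omega> that unfolding score_root_estimator_def by blast
    with assms(2) items[OF \<omega>] lim have conv: "(\<lambda>n. est n \<omega>) \<longlonglongrightarrow> \<theta>"
      by (rule score_root_near)
    with assms(2) items[OF \<omega>]
    have "(\<lambda>n. info b n (est n \<omega>) \<omega> / info b n \<theta> \<omega>) \<longlonglongrightarrow> 1"
      by (rule info_ratio_tendsto)
    with conv show "(\<lambda>n. est n \<omega>) \<longlonglongrightarrow> \<theta> \<and>
        (\<lambda>n. info b n (est n \<omega>) \<omega> / info b n \<theta> \<omega>) \<longlonglongrightarrow> 1" ..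
  qed
qed

end
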